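(* Let $G$ be any subdivision of the complete graph $K_4$ (each edge of $K_4$ replaced by a path with an arbitrary number $\ge 0$ of internal vertices). Then $G$ admits a crumby coloring.
   Context: A crumby coloring of a graph $H$ is a coloring of the vertices of $H$ with two colors, red and blue, such that the subgraph induced by the blue vertices has maximum degree at most $1$, and the subgraph induced by the red vertices has minimum degree at least $1$ and contains no path with $3$ edges. *)

theory Defs
  imports "Graph_Theory.Graph_Theory"
begin

text \<open>
  As in the session Graph_Theory, an undirected graph is represented by a symmetric digraph in
  which every edge is a pair of mutually reverse arcs. The degree of a vertex is therefore its
  out-degree, and a path with 3 edges is an arc path (\<open>apath\<close>, a walk without repeated
  vertices) of length 3.
\<close>

datatype crumby_color = Red | Blue

definition color_subgraph ::
    "('a, 'b) pre_digraph \<Rightarrow> ('a \<Rightarrow> crumby_color) \<Rightarrow> crumby_color \<Rightarrow> ('a, 'b) pre_digraph" where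
  "color_subgraph H c k = H \<restriction> {v \<in> verts H. c v = k}"

text \<open>
  Only the values of the coloring on \<open>verts H\<close> matter. The degree conditions hold vacuously for
  an empty color class. The red condition forbids all paths with 3 edges, induced or not.
\<close>

definition crumby_coloring :: "('a, 'b) pre_digraph \<Rightarrow> ('a \<Rightarrow> crumby_color) \<Rightarrow> bool" where
  "crumby_coloring H c \<longleftrightarrow>
     (\<forall>v \<in> verts (color_subgraph H c Blue). out_degree (color_subgraph H c Blue) v \<le> 1) \<and>
     (\<forall>v \<in> verts (color_subgraph H c Red). out_degree (color_subgraph H c Red) v \<ge> 1) \<and>
     \<not> (\<exists>u p v. pre_digraph.apath (color_subgraph H c Red) u p v \<and> length p = 3)"

end

theory Submission
  imports Defs
begin

text \<open>
  Call red vertices leaves or centers. If every leaf has exactly one red neighbour, every center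
  has a red neighbour and no two centers are adjacent, then the red components are stars, so that
  together with the degree condition on the blue vertices the coloring is crumby. This is a local
  condition, and three consecutive new vertices can be inserted into any path of a subdivision
  without destroying it. Hence only the numbers of inner vertices of the six paths modulo 3
  matter, and finitely many cases remain.
\<close>

section \<open>Roles of vertices and words along paths\<close>

text \<open>Red triangles would also be crumby, but stars have a certificate that compares each
  vertex only with its neighbours. Once every branch vertex has a role and a planned color for each
  of its three neighbours, the six paths no longer interact: each only needs a word with prescribed
  end roles that respects the planned colors next to its ends. Words can be lengthened by three but
  not shortened, so each residue is settled at its least representative. The critical residue is 0:
  a bare edge offers no inner vertex to choose, and the neighbours there are branch vertices
  themselves. On the graph side a subdivision is generated by splitting one edge at a time and comes
  without paths. A family of six paths is therefore carried through the induction as an invariant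
  (\<open>path_system\<close>).\<close>

datatype role = Bl | Leaf | Center

text \<open>
  The list tells for each neighbour of a vertex whether it is red. Two red vertices that are
  joined by an edge without further red neighbours are both leaves.
\<close>

fun role_ok :: "role \<Rightarrow> bool list \<Rightarrow> bool" where
  "role_ok Bl rs \<longleftrightarrow> length (filter Not rs) \<le> 1"
| "role_ok Leaf rs \<longleftrightarrow> length (filter id rs) = 1"
| "role_ok Center rs \<longleftrightarrow> True \<in> set rs"

abbreviation red :: "role \<Rightarrow> bool" where
  "red t \<equiv> t \<noteq> Bl"

text \<open>The two end letters are tested only for adjacent centers, because the other neighbours
  of a branch vertex lie on other paths.\<close>

fun word_ok :: "role list \<Rightarrow> bool" where
  "word_ok (a # b # c # w) \<longleftrightarrow>
     role_ok b [red a, red c] \<and> \<not> (a = Center \<and> b = Center) \<and> word_ok (b # c # w)"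
| "word_ok [a, b] \<longleftrightarrow> \<not> (a = Center \<and> b = Center)"
| "word_ok _ \<longleftrightarrow> True"

text \<open>
  \<open>end_ok x r r'\<close> says that a branch vertex with role \<open>x\<close> for which a neighbour of color \<open>r\<close> was
  planned tolerates the color \<open>r'\<close> instead. The slack is needed for two adjacent blue branch
  vertices: the only ways to lengthen that edge by three make a neighbour red.
\<close>

definition end_ok :: "role \<Rightarrow> bool \<Rightarrow> bool \<Rightarrow> bool" where
  "end_ok x r r' \<longleftrightarrow> r' = r \<or> r' \<and> x \<noteq> Leaf"

text \<open>Extra red neighbours never hurt a blue vertex or a center, and for a leaf
  \<open>end_ok\<close> demands the planned color itself.\<close>

lemma role_ok_mono:
  assumes "role_ok x (map g js)" "\<And>j. j \<in> set js \<Longrightarrow> end_ok x (g j) (h j)"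
  shows "role_ok x (map h js)"
proof (cases x)
  case Bl
  have "length (filter Not (map h js)) \<le> length (filter Not (map g js))"
    using assms(2) by (induction js) (auto simp: end_ok_def le_SucI)
  then show ?thesis using assms(1) Bl by simp
next
  case Leaf
  then have "map h js = map g js" using assms(2) by (auto simp: end_ok_def)
  then show ?thesis using assms(1) by metis
next
  case Center
  then show ?thesis using assms by (fastforce simp: end_ok_def)
qed

text \<open>Here \<open>n\<close> counts inner vertices. For \<open>n = 0\<close> the positions
  \<open>1\<close> and \<open>n\<close> are the opposite ends, so a bare edge needs no separate
  case.\<close>

definition spells :: "role list \<Rightarrow> nat \<Rightarrow> role \<Rightarrow> bool \<Rightarrow> bool \<Rightarrow> role \<Rightarrow> bool" where
  "spells w n x r s y \<longleftrightarrow> length w = n + 2 \<and> word_ok w \<and> hd w = x \<and> last w = y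
     \<and> end_ok x r (red (w ! 1)) \<and> end_ok y s (red (w ! n))"

text \<open>
  The three new letters go behind the first one, and the first and third of them have the
  colors of \<open>b\<close> and \<open>a\<close>, so that no old letter notices the insertion
  (except when \<open>a = b = Bl\<close>).
\<close>

lemma spells_add_3:
  assumes "spells w n x r s y"
  shows "\<exists>w'. spells w' (n + 3) x r s y"
proof -
  obtain a b v where w: "w = a # b # v"
    using assms unfolding spells_def by (cases w; cases "tl w") auto
  define u where "u = (if b = Bl then [Bl, Leaf, Leaf] else if a = Bl then [Leaf, Leaf, Bl]
    else [Leaf, Bl, Leaf])"
  have "spells (a # u @ b # v) (n + 3) x r s y"
    using assms unfolding spells_def end_ok_def w u_def
    by (cases n; cases v; cases a; cases b) auto
  then show ?thesis ..
qed

lemma spells_mod_3: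
  assumes "spells w (n mod 3) x r s y"
  shows "\<exists>w'. spells w' n x r s y"
proof -
  have "\<exists>w'. spells w' (n mod 3 + 3 * m) x r s y" for m
  proof (induction m)
    case (Suc m)
    then show ?case using spells_add_3[of _ "n mod 3 + 3 * m"] by (auto simp: algebra_simps)
  qed (use assms in auto)
  from this[of "n div 3"] show ?thesis by simp
qed

section \<open>The finite check on path lengths modulo three\<close>

definition edge_pairs :: "(nat \<times> nat) list" where
  "edge_pairs = [(0,1), (0,2), (0,3), (1,2), (1,3), (2,3)]"

definition edge_value :: "'c list \<Rightarrow> nat \<Rightarrow> nat \<Rightarrow> 'c" where
  "edge_value vs i j = the (map_of (zip edge_pairs vs) (min i j, max i j))"

text \<open>
  Each entry consists of the roles of the four branch vertices, the pairs \<open>(i, j)\<close> such that the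
  neighbour of branch vertex \<open>i\<close> towards \<open>j\<close> is red, and for each edge the admissible numbers of
  inner vertices modulo 3, in the order of \<open>edge_pairs\<close>. Up to the 24 symmetries of the complete
  graph, these 14 entries cover all 729 cases. They were found by a computer search.
\<close>

definition schemes :: "(role list \<times> (nat \<times> nat) list \<times> nat list list) list" where
  "schemes =
   [
    ([Leaf, Leaf, Leaf, Leaf], [(0,3),(1,2),(2,1),(3,0)],
     [[1,2], [1,2], [0,1], [0,1], [1,2], [1,2]]),
    ([Bl, Leaf, Leaf, Leaf], [(0,2),(0,3),(1,2),(2,1),(3,0)],
     [[1], [0], [1,2], [0,1], [1,2], [1,2]]),
    ([Bl, Leaf, Leaf, Leaf], [(0,1),(0,2),(0,3),(1,3),(2,0),(3,0)],
     [[0], [1,2], [1,2], [1,2], [2], [1,2]]),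
    ([Bl, Leaf, Leaf, Leaf], [(0,1),(0,2),(0,3),(1,2),(2,1),(3,0)],
     [[0], [0], [1,2], [0,1], [1,2], [1,2]]),
    ([Bl, Bl, Leaf, Leaf], [(0,2),(0,3),(1,2),(1,3),(2,1),(3,0)],
     [[0], [0], [1,2], [1,2], [0], [1,2]]),
    ([Bl, Leaf, Leaf, Center], [(0,1),(0,2),(1,3),(2,0),(3,0),(3,1)],
     [[0], [1,2], [2], [1,2], [0], [1,2]]),
    ([Bl, Leaf, Leaf, Leaf], [(0,1),(0,2),(0,3),(1,0),(2,0),(3,0)],
     [[1,2], [1,2], [1,2], [1,2], [1,2], [1,2]]),
    ([Bl, Leaf, Leaf, Leaf], [(0,1),(0,2),(0,3),(1,3),(2,3),(3,2)],
     [[0], [0], [0], [1,2], [2], [0,1]]),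
    ([Bl, Leaf, Leaf, Center], [(0,2),(0,3),(1,3),(2,3),(3,1),(3,2)],
     [[1], [0], [0], [1,2], [0], [0]]),
    ([Bl, Bl, Leaf, Leaf], [(0,2),(0,3),(1,2),(1,3),(2,1),(3,1)],
     [[0], [0], [0], [1,2], [1,2], [1,2]]),
    ([Bl, Bl, Leaf, Leaf], [(0,1),(0,2),(0,3),(1,0),(1,2),(1,3),(2,3),(3,2)],
     [[2], [0], [0], [0], [0], [0,1]]),
    ([Bl, Leaf, Leaf, Center], [(0,1),(0,2),(1,3),(2,3),(3,1),(3,2)],
     [[0], [0], [1], [1,2], [0], [0]]),
    ([Bl, Leaf, Leaf, Center], [(0,1),(0,2),(1,3),(2,3),(3,0),(3,1),(3,2)],
     [[0], [0], [2], [1,2], [0], [0]]),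
    ([Bl, Bl, Leaf, Leaf], [(0,2),(0,3),(1,2),(1,3),(2,3),(3,2)],
     [[0], [0], [0], [0], [0], [0,1]])
   ]"

text \<open>The 24 renumberings: branch vertex \<open>i\<close> plays the part of vertex
  \<open>p ! i\<close> of a scheme.\<close>

definition vertex_orders :: "nat list list" where
  "vertex_orders = filter distinct (List.n_lists 4 [0,1,2,3])"

text \<open>On the entries of a renumbering this is the inverse permutation.\<close>

definition position :: "nat list \<Rightarrow> nat \<Rightarrow> nat" where
  "position p a = length (takeWhile (\<lambda>b. b \<noteq> a) p)"

text \<open>With \<open>[0,1,2,3,4,5]\<close> as values, \<open>edge_value\<close> returns the index
  of an edge. Thus \<open>map (nth ns) (edge_order p)\<close> lists the residues \<open>ns\<close>
  in the edge order of the scheme.\<close>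

definition edge_order :: "nat list \<Rightarrow> nat list" where
  "edge_order p = map (\<lambda>(a, b). edge_value [0,1,2,3,4,5] (position p a) (position p b)) edge_pairs"

definition in_some_box :: "nat list \<Rightarrow> bool" where
  "in_some_box ms \<longleftrightarrow> list_ex (\<lambda>(xs, hs, bs). list_all2 (\<lambda>m b. m \<in> set b) ms bs) schemes"

text \<open>
  The edge orders are a parameter so that \<open>code_simp\<close> evaluates them only once.
\<close>

definition covering :: "nat list list \<Rightarrow> bool" where
  "covering ess \<longleftrightarrow>
     list_all (\<lambda>ns. list_ex (\<lambda>es. in_some_box (map (nth ns) es)) ess) (List.n_lists 6 [0,1,2])"

lemma covering_edge_orders: "covering (map edge_order vertex_orders)"
  by code_simp

text \<open>Checking every renumbering gives the neighbours in the order used later and spares a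
  proof that \<open>role_ok\<close> is invariant under permutations.\<close>

lemma schemes_role_ok:
  "\<forall>(xs, hs, bs) \<in> set schemes. \<forall>p \<in> set vertex_orders. \<forall>i \<in> {0,1,2,3}.
     role_ok (xs ! (p ! i))
       (map (\<lambda>j. (p ! i, p ! j) \<in> set hs) (filter (\<lambda>j. j \<noteq> i) [0,1,2,3]))"
  by code_simp

text \<open>A search through at most 81 words per edge, as \<open>n\<close> is at most 2. Both
  orientations are searched because a renumbering may reverse an edge.\<close>

lemma schemes_spells:
  "\<forall>(xs, hs, bs) \<in> set schemes. \<forall>i \<in> {0,1,2,3}. \<forall>j \<in> {0,1,2,3} - {i}. \<forall>n \<in> set (edge_value bs i j).
     \<exists>w \<in> set (List.n_lists (n + 2) [Bl, Leaf, Center]).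
       spells w n (xs ! i) ((i, j) \<in> set hs) ((j, i) \<in> set hs) (xs ! j)"
  by code_simp

lemma edge_value_commute: "edge_value vs i j = edge_value vs j i"
  by (simp add: edge_value_def min.commute max.commute)

lemma edge_pairs_cases:
  assumes "i < 4" "j < 4" "i \<noteq> j"
  obtains e where "e < 6" "edge_pairs ! e = (i, j) \<or> edge_pairs ! e = (j, i)"
proof -
  have ij: "i \<in> {0,1,2,3}" "j \<in> {0,1,2,3}"
    using assms(1,2) by (simp_all only: insert_iff empty_iff) presburger+
  have "(i, j) \<in> set edge_pairs \<or> (j, i) \<in> set edge_pairs"
    using ij assms(3) by (auto simp: edge_pairs_def)
  moreover have "length edge_pairs = 6" by (simp add: edge_pairs_def)
  ultimately show thesis using that by (metis in_set_conv_nth)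
qed

lemma edge_value_nth:
  assumes "length vs = 6" "e < 6" "edge_pairs ! e = (a, b)"
  shows "edge_value vs a b = vs ! e"
proof -
  have len: "length edge_pairs = 6" and "distinct edge_pairs"
    by (simp_all add: edge_pairs_def)
  then have "map_of (zip edge_pairs vs) (edge_pairs ! e) = Some (vs ! e)"
    using assms by (intro map_of_zip_nth) auto
  moreover have "(a, b) \<in> set edge_pairs"
    using assms len by (metis nth_mem)
  then have "a < b" by (auto simp: edge_pairs_def)
  ultimately show ?thesis
    using assms(3) by (simp add: edge_value_def min_def max_def)
qed

lemma edge_value_map:
  "(i, j) \<in> set edge_pairs \<Longrightarrow> edge_value (map (\<lambda>(i, j). h i j) edge_pairs) i j = h i j"
  by (auto simp: edge_value_def edge_pairs_def)

text \<open>The combinatorial core, for arbitrary numbers \<open>k i j\<close> of inner vertices: a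
  scheme whose box contains the residues supplies \<open>x\<close> and \<open>r\<close>, after which
  each edge gets its word separately.\<close>

lemma exists_roles:
  fixes k :: "nat \<Rightarrow> nat \<Rightarrow> nat"
  shows "\<exists>x r. (\<forall>i \<in> {0,1,2,3}. role_ok (x i) (map (r i) (filter (\<lambda>j. j \<noteq> i) [0,1,2,3]))) \<and>
    (\<forall>i j. (i, j) \<in> set edge_pairs \<longrightarrow> (\<exists>w. spells w (k i j) (x i) (r i j) (r j i) (x j)))"
proof -
  define ns where "ns = map (\<lambda>(i, j). k i j mod 3) edge_pairs"
  have ns: "length ns = 6" "set ns \<subseteq> {0,1,2}"
    by (auto simp: ns_def edge_pairs_def)
  then have "ns \<in> set (List.n_lists 6 [0,1,2])"
    by (simp add: set_n_lists)
  then obtain p where p: "p \<in> set vertex_orders" and "in_some_box (map (nth ns) (edge_order p))"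
    using covering_edge_orders unfolding covering_def by (auto simp: list_all_iff list_ex_iff)
  then obtain xs hs bs where s: "(xs, hs, bs) \<in> set schemes"
    and box: "list_all2 (\<lambda>m b. m \<in> set b) (map (nth ns) (edge_order p)) bs"
    by (auto simp: in_some_box_def list_ex_iff)
  have len: "length p = 4" and dist: "distinct p" and set_p: "set p \<subseteq> {0,1,2,3}"
    using p unfolding vertex_orders_def by (auto simp: set_n_lists)
  have position: "position p (p ! i) = i" if "i < 4" for i
  proof -
    have "\<forall>l < i. p ! l \<noteq> p ! i"
      using that len dist by (metis nat_neq_iff nth_eq_iff_index_eq order_less_trans)
    then have "\<forall>b \<in> set (take i p). b \<noteq> p ! i"
      using that len by (auto simp: in_set_conv_nth)
    then have "takeWhile (\<lambda>b. b \<noteq> p ! i) (take i p @ p ! i # drop (Suc i) p) = take i p"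
      by (simp add: takeWhile_tail takeWhile_eq_all_conv)
    then have "takeWhile (\<lambda>b. b \<noteq> p ! i) p = take i p"
      using that len by (simp only: id_take_nth_drop[symmetric])
    then show ?thesis
      unfolding position_def using that len by simp
  qed
  have index: "edge_value ns i j = ns ! edge_value [0,1,2,3,4,5] i j"
    if "i < 4" "j < 4" "i \<noteq> j" for i j
  proof -
    from that obtain e where "e < 6" "edge_pairs ! e = (i, j) \<or> edge_pairs ! e = (j, i)"
      using edge_pairs_cases by blast
    moreover have "[0,1,2,3,4,5] ! e = e"
      using nth_upt[of 0 e 6] \<open>e < 6\<close> by (simp add: upt_rec numeral_eq_Suc)
    ultimately show ?thesis
      using edge_value_nth[of ns e] edge_value_nth[of "[0,1,2,3,4,5::nat]" e] ns
      by (auto simp: edge_value_commute[of _ i j])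
  qed
  \<comment> \<open>The box condition is indexed by the edges of the scheme; \<open>position\<close>
    carries each of them back to the edge of the graph that it stands for.\<close>
  have allowed: "edge_value ns i j \<in> set (edge_value bs (p ! i) (p ! j))"
    if ij: "i < 4" "j < 4" and "(p ! i, p ! j) \<in> set edge_pairs" for i j
  proof -
    from that obtain e where e: "e < length edge_pairs" "edge_pairs ! e = (p ! i, p ! j)"
      by (auto simp: in_set_conv_nth)
    moreover from this have "e < 6" by (simp add: edge_pairs_def)
    ultimately have "i \<noteq> j" using that by (auto simp: edge_pairs_def)
    have "map (nth ns) (edge_order p) ! e = edge_value ns i j"
      using e position ij index[OF ij \<open>i \<noteq> j\<close>] by (simp add: edge_order_def)
    moreover have "bs ! e = edge_value bs (p ! i) (p ! j)"
      using edge_value_nth[of bs e] list_all2_lengthD[OF box] e \<open>e < 6\<close>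
      by (simp add: edge_order_def edge_pairs_def)
    ultimately show ?thesis
      using list_all2_nthD[OF box, of e] e by (simp add: edge_order_def)
  qed
  show ?thesis
  proof (rule exI[of _ "\<lambda>i. xs ! (p ! i)"], rule exI[of _ "\<lambda>i j. (p ! i, p ! j) \<in> set hs"],
      intro conjI ballI allI impI)
    show "role_ok (xs ! (p ! i)) (map (\<lambda>j. (p ! i, p ! j) \<in> set hs) (filter (\<lambda>j. j \<noteq> i) [0,1,2,3]))"
      if "i \<in> {0,1,2,3}" for i
      using schemes_role_ok[THEN bspec, OF s, unfolded prod.case, THEN bspec, OF p] that by blast
  next
    fix i j assume ij: "(i, j) \<in> set edge_pairs"
    then have lt: "i < 4" "j < 4" "i \<noteq> j" by (auto simp: edge_pairs_def)
    then have "p ! i \<in> set p" "p ! j \<in> set p" "p ! i \<noteq> p ! j"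
      using len dist by (simp_all add: nth_eq_iff_index_eq)
    then have *: "p ! i \<in> {0,1,2,3}" "p ! j \<in> {0,1,2,3}" "p ! i \<noteq> p ! j"
      using set_p by (blast, blast, simp)
    \<comment> \<open>\<open>allowed\<close> covers only pairs that \<open>p\<close> keeps
      increasing; a reversed pair is handled by the symmetry of \<open>edge_value\<close>.\<close>
    then have "(p ! i, p ! j) \<in> set edge_pairs \<or> (p ! j, p ! i) \<in> set edge_pairs"
      unfolding edge_pairs_def by auto
    then have "edge_value ns i j \<in> set (edge_value bs (p ! i) (p ! j))"
      using allowed lt by (metis edge_value_commute)
    then have "k i j mod 3 \<in> set (edge_value bs (p ! i) (p ! j))"
      unfolding ns_def by (simp only: edge_value_map[OF ij, of "\<lambda>i j. k i j mod 3"])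
    moreover have "p ! j \<in> {0,1,2,3} - {p ! i}"
      using * by simp
    ultimately obtain w where
      "spells w (k i j mod 3) (xs ! (p ! i)) ((p ! i, p ! j) \<in> set hs) ((p ! j, p ! i) \<in> set hs) (xs ! (p ! j))"
      using schemes_spells[THEN bspec, OF s, unfolded prod.case, THEN bspec, OF *(1), THEN bspec]
      by blast
    then show "\<exists>w. spells w (k i j) (xs ! (p ! i)) ((p ! i, p ! j) \<in> set hs) ((p ! j, p ! i) \<in> set hs) (xs ! (p ! j))"
      by (rule spells_mod_3)
  qed
qed

section \<open>From roles to crumby colorings\<close>

text \<open>Without parallel arcs the head map is injective on the arcs leaving \<open>v\<close>, so
  counting arcs becomes counting neighbours.\<close>

lemma out_degree_color_subgraph:
  assumes "nomulti_digraph G" "v \<in> verts G" "c v = k"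
  shows "out_degree (color_subgraph G c k) v = card {u. (v, u) \<in> arcs_ends G \<and> c u = k}"
proof -
  interpret nomulti_digraph G by fact
  let ?A = "{e \<in> arcs G. tail G e = v \<and> c (head G e) = k}"
  have "out_arcs (color_subgraph G c k) v = ?A"
    using assms(2,3) by (auto simp: color_subgraph_def out_arcs_def)
  moreover have "inj_on (head G) ?A"
    by (rule inj_onI) (auto intro!: no_multi_arcs simp: arc_to_ends_def)
  moreover have "head G ` ?A = {u. (v, u) \<in> arcs_ends G \<and> c u = k}"
    by (auto simp: arcs_ends_conv)
  ultimately show ?thesis
    unfolding out_degree_def using card_image[of "head G" ?A] by simp
qed

lemma role_ok_red_neighbours:
  assumes "role_ok (f v) (map (\<lambda>u. red (f u)) ns)"
    and "y \<in> set ns" "z \<in> set ns" "y \<noteq> z" "red (f v)" "red (f y)" "red (f z)"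
  shows "f v = Center"
proof (rule ccontr)
  assume "f v \<noteq> Center"
  with assms(5) have "f v = Leaf" by (cases "f v") auto
  with assms(1) obtain a where "filter (\<lambda>u. red (f u)) ns = [a]"
    by (auto simp: filter_map o_def length_Suc_conv)
  then have "{u \<in> set ns. red (f u)} = {a}"
    by (simp flip: set_filter)
  then have "y = a" "z = a"
    using assms(2,3,6,7) by auto
  with assms(4) show False by simp
qed

text \<open>
  The red components obtained this way are stars: in a path with three red edges both inner
  vertices would have two red neighbours each and hence be adjacent centers.
\<close>

lemma crumby_coloringI:
  assumes G: "nomulti_digraph G" "symmetric G"
    and nbrs: "\<And>v. v \<in> verts G \<Longrightarrow>
      \<exists>ns. {u. (v, u) \<in> arcs_ends G} = set ns \<and> role_ok (f v) (map (\<lambda>u. red (f u)) ns)"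
    and centers: "\<And>u v. (u, v) \<in> arcs_ends G \<Longrightarrow> \<not> (f u = Center \<and> f v = Center)"
  shows "crumby_coloring G (\<lambda>v. if f v = Bl then Blue else Red)"
proof -
  interpret nomulti_digraph G by fact
  define c where "c v = (if f v = Bl then Blue else Red)" for v
  have c_simps: "c v = Blue \<longleftrightarrow> f v = Bl" "c v = Red \<longleftrightarrow> f v \<noteq> Bl" for v
    by (auto simp: c_def)
  have in_verts: "v \<in> verts (color_subgraph G c k) \<longleftrightarrow> v \<in> verts G \<and> c v = k" for v k
    by (auto simp: color_subgraph_def)
  have blue: "out_degree (color_subgraph G c Blue) v \<le> 1" if v: "v \<in> verts G" "c v = Blue" for v
  proof -
    obtain ns where ns: "{u. (v, u) \<in> arcs_ends G} = set ns"
      "role_ok (f v) (map (\<lambda>u. red (f u)) ns)" using nbrs v by blast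
    have "{u. (v, u) \<in> arcs_ends G \<and> c u = Blue} = set (filter (\<lambda>u. f u = Bl) ns)"
      using ns(1) by (auto simp: c_simps)
    \<comment> \<open>The list \<open>ns\<close> may contain repetitions, so only this inequality is
      available; it has the required direction.\<close>
    then have "card {u. (v, u) \<in> arcs_ends G \<and> c u = Blue} \<le> length (filter (\<lambda>u. f u = Bl) ns)"
      by (metis card_length)
    also have "\<dots> \<le> 1"
      using ns(2) v(2) by (simp add: c_simps filter_map o_def)
    finally show ?thesis unfolding out_degree_color_subgraph[of G v c, OF G(1) v] .
  qed
  have red: "1 \<le> out_degree (color_subgraph G c Red) v" if v: "v \<in> verts G" "c v = Red" for v
  proof -
    obtain ns where ns: "{u. (v, u) \<in> arcs_ends G} = set ns"
      "role_ok (f v) (map (\<lambda>u. red (f u)) ns)" using nbrs v by blast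
    have eq: "{u. (v, u) \<in> arcs_ends G \<and> c u = Red} = set (filter (\<lambda>u. red (f u)) ns)"
      using ns(1) by (auto simp: c_simps)
    have "filter (\<lambda>u. red (f u)) ns \<noteq> []"
    proof
      assume *: "filter (\<lambda>u. red (f u)) ns = []"
      then have "\<forall>u\<in>set ns. \<not> red (f u)" by (simp add: filter_empty_conv)
      with * show False using ns(2) v(2) by (cases "f v") (auto simp: c_simps filter_map o_def)
    qed
    then have "card (set (filter (\<lambda>u. red (f u)) ns)) \<noteq> 0"
      by (metis card_0_eq List.finite_set set_empty)
    then show ?thesis
      unfolding out_degree_color_subgraph[of G v c, OF G(1) v] eq by linarith
  qed
  have no_path: False
    if path: "pre_digraph.apath (color_subgraph G c Red) u p v" and len: "length p = 3" for u p v
  proof -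
    obtain e1 e2 e3 where p: "p = [e1, e2, e3]"
      using len by (auto simp: length_Suc_conv numeral_eq_Suc)
    define x1 x2 x3 where "x1 = head G e1" and "x2 = head G e2" and "x3 = head G e3"
    have "e1 \<in> arcs G" "e2 \<in> arcs G" "e3 \<in> arcs G" "tail G e1 = u" "tail G e2 = x1" "tail G e3 = x2"
      and red: "red (f u)" "red (f x1)" "red (f x2)" "red (f x3)"
      and dist: "u \<noteq> x2" "x1 \<noteq> x3"
      using path unfolding p x1_def x2_def x3_def pre_digraph.apath_def pre_digraph.awalk_def
      by (auto simp: pre_digraph.cas.simps pre_digraph.awalk_verts.simps color_subgraph_def c_simps)
    then have e: "(u, x1) \<in> arcs_ends G" "(x1, x2) \<in> arcs_ends G" "(x2, x3) \<in> arcs_ends G"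
      by (auto simp: arcs_ends_conv x1_def x2_def x3_def intro!: image_eqI)
    then have e': "(x1, u) \<in> arcs_ends G" "(x2, x1) \<in> arcs_ends G"
      using arcs_ends_symmetric[OF G(2)] by blast+
    have center: "f x = Center"
      if xy: "(x, y) \<in> arcs_ends G" "(x, z) \<in> arcs_ends G" "y \<noteq> z" "red (f x)" "red (f y)" "red (f z)"
      for x y z
    proof -
      obtain ns where ns: "{u. (x, u) \<in> arcs_ends G} = set ns"
        "role_ok (f x) (map (\<lambda>u. red (f u)) ns)"
        using nbrs[OF adj_in_verts(1)[OF xy(1)]] by blast
      have "y \<in> set ns" "z \<in> set ns"
        using xy(1,2) ns(1) by auto
      then show ?thesis
        using role_ok_red_neighbours[where f = f, OF ns(2)] xy(3-6) by simp
    qed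
    have "f x1 = Center" "f x2 = Center"
      using center[of x1 u x2] center[of x2 x1 x3] e e' dist red by auto
    with centers e(2) show False by blast
  qed
  have "crumby_coloring G c"
    unfolding crumby_coloring_def
  proof (intro conjI ballI notI)
    show "out_degree (color_subgraph G c Blue) v \<le> 1" if "v \<in> verts (color_subgraph G c Blue)" for v
      using blue that unfolding in_verts by simp
    show "1 \<le> out_degree (color_subgraph G c Red) v" if "v \<in> verts (color_subgraph G c Red)" for v
      using red that unfolding in_verts by simp
    show False if "\<exists>u p v. pre_digraph.apath (color_subgraph G c Red) u p v \<and> length p = 3"
      using that no_path by auto
  qed
  then show ?thesis unfolding c_def .
qed

section \<open>Subdivisions as systems of paths\<close>

fun path_edges :: "'a list \<Rightarrow> ('a \<times> 'a) set" where
  "path_edges (a # b # l) = {(a, b), (b, a)} \<union> path_edges (b # l)"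
| "path_edges _ = {}"

text \<open>Meant to be applied to all paths of a system alike: paths that do not use the split edge
  stay unchanged.\<close>

fun insert_between :: "'a \<Rightarrow> 'a \<Rightarrow> 'a \<Rightarrow> 'a list \<Rightarrow> 'a list" where
  "insert_between u v w (a # b # l) =
     (if (a, b) = (u, v) \<or> (a, b) = (v, u) then a # w # insert_between u v w (b # l)
      else a # insert_between u v w (b # l))"
| "insert_between u v w l = l"

lemma path_edges_Cons:
  "m \<noteq> [] \<Longrightarrow> path_edges (a # m) = {(a, hd m), (hd m, a)} \<union> path_edges m"
  by (cases m) auto

lemma path_edges_subset: "path_edges l \<subseteq> set l \<times> set l"
  by (induction l rule: path_edges.induct) auto

lemma path_edges_sym: "(u, v) \<in> path_edges l \<Longrightarrow> (v, u) \<in> path_edges l"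
  by (induction l rule: path_edges.induct) auto

lemma insert_between_Nil_iff [simp]: "insert_between u v w l = [] \<longleftrightarrow> l = []"
  by (cases "(u, v, w, l)" rule: insert_between.cases) auto

lemma hd_insert_between [simp]: "hd (insert_between u v w l) = hd l"
  by (cases "(u, v, w, l)" rule: insert_between.cases) auto

lemma last_insert_between [simp]: "last (insert_between u v w l) = last l"
  by (induction u v w l rule: insert_between.induct) auto

lemma length_insert_between: "length l \<le> length (insert_between u v w l)"
  by (induction u v w l rule: insert_between.induct) auto

lemma insert_between_id: "(u, v) \<notin> path_edges l \<Longrightarrow> insert_between u v w l = l"
  by (induction u v w l rule: insert_between.induct) (auto dest: path_edges_sym)

lemma insert_between_not_in: "u \<notin> set l \<or> v \<notin> set l \<Longrightarrow> insert_between u v w l = l"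
  using path_edges_subset by (metis SigmaD1 SigmaD2 insert_between_id subsetD)

lemma set_insert_between:
  "(u, v) \<in> path_edges l \<Longrightarrow> set (insert_between u v w l) = insert w (set l)"
proof (induction u v w l rule: insert_between.induct)
  case (1 u v w a b l)
  show ?case
  proof (cases "(u, v) \<in> path_edges (b # l)")
    case True
    then show ?thesis using 1 by auto
  next
    case False
    then have "insert_between u v w (b # l) = b # l" by (rule insert_between_id)
    then show ?thesis using 1 False by auto
  qed
qed auto

lemma insert_between_Cons:
  assumes "distinct (a # b # l)" "(a, b) = (u, v) \<or> (a, b) = (v, u)"
  shows "insert_between u v w (a # b # l) = a # w # b # l"
  using assms insert_between_not_in[of u "b # l" v w] by auto

lemma distinct_insert_between:
  assumes "distinct l" "w \<notin> set l"
  shows "distinct (insert_between u v w l)"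
  using assms
proof (induction u v w l rule: insert_between.induct)
  case (1 u v w a b l)
  show ?case
  proof (cases "(a, b) = (u, v) \<or> (a, b) = (v, u)")
    case True
    then show ?thesis using 1(3,4) insert_between_Cons[of a b l u v w] by auto
  next
    case False
    have "set (insert_between u v w (b # l)) \<subseteq> insert w (set (b # l))"
      by (metis set_insert_between insert_between_id subset_insertI order_refl)
    then show ?thesis using 1 False by auto
  qed
qed auto

lemma path_edges_insert_between:
  assumes "distinct l" "w \<notin> set l" "(u, v) \<in> path_edges l"
  shows "path_edges (insert_between u v w l) =
    path_edges l - {(u, v), (v, u)} \<union> {(u, w), (w, u), (v, w), (w, v)}"
  using assms
proof (induction u v w l rule: insert_between.induct)
  case (1 u v w a b l)
  have a: "(a, x) \<notin> path_edges (b # l)" "(x, a) \<notin> path_edges (b # l)" for x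
    using 1(3) path_edges_subset[of "b # l"] by auto
  show ?case
  proof (cases "(a, b) = (u, v) \<or> (a, b) = (v, u)")
    case True
    then have "insert_between u v w (a # b # l) = a # w # b # l"
      using 1(3) insert_between_Cons by metis
    then show ?thesis using True a by auto
  next
    case False
    then have "(u, v) \<in> path_edges (b # l)" using 1(5) by auto
    moreover from this have "a \<noteq> u" "a \<noteq> v" using a by auto
    ultimately show ?thesis using 1 False by (auto simp: path_edges_Cons)
  qed
qed auto

section \<open>Neighbours and roles along a single path\<close>

lemma neighbours_hd:
  assumes "distinct l" "2 \<le> length l"
  shows "{u. (hd l, u) \<in> path_edges l} = {l ! 1}"
proof (cases l rule: path_edges.cases)
  case (1 a b m)
  then show ?thesis using assms path_edges_subset[of "b # m"] by auto
qed (use assms in auto)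

lemma neighbours_last:
  assumes "distinct l" "2 \<le> length l"
  shows "{u. (last l, u) \<in> path_edges l} = {l ! (length l - 2)}"
  using assms
proof (induction l rule: path_edges.induct)
  case (1 a b m)
  show ?case
  proof (cases m)
    case (Cons c m')
    have "last (b # m) \<noteq> a" "last (b # m) \<noteq> b" using 1(2) Cons by auto
    then show ?thesis using 1 Cons by auto
  qed (use 1 in auto)
qed auto

lemma neighbours_inner:
  assumes "distinct l" "word_ok (map f l)" "v \<in> set l" "v \<noteq> hd l" "v \<noteq> last l"
  shows "\<exists>ns. {u. (v, u) \<in> path_edges l} = set ns \<and> role_ok (f v) (map (\<lambda>u. red (f u)) ns)"
  using assms
proof (induction l rule: path_edges.induct)
  case (1 a b l)
  show ?case
  proof (cases l)
    case (Cons c m)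
    show ?thesis
    proof (cases "v = b")
      case True
      then have "{u. (v, u) \<in> path_edges (a # b # l)} = set [a, c]"
        using 1(2) Cons neighbours_hd[of "b # l"] by auto
      moreover have "role_ok (f v) (map (\<lambda>u. red (f u)) [a, c])"
        using 1(3) Cons True by simp
      ultimately show ?thesis by blast
    next
      case False
      then have "{u. (v, u) \<in> path_edges (a # b # l)} = {u. (v, u) \<in> path_edges (b # l)}"
        using 1(5) by auto
      moreover have "\<exists>ns. {u. (v, u) \<in> path_edges (b # l)} = set ns \<and> role_ok (f v) (map (\<lambda>u. red (f u)) ns)"
        using 1 Cons False by auto
      ultimately show ?thesis by simp
    qed
  qed (use 1 in auto)
qed auto

lemma centers_not_adjacent:
  "word_ok (map f l) \<Longrightarrow> (u, v) \<in> path_edges l \<Longrightarrow> \<not> (f u = Center \<and> f v = Center)"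
proof (induction l rule: path_edges.induct)
  case (1 a b l)
  then show ?case by (cases l) auto
qed auto

text \<open>\<open>S\<close> is the set of branch vertices. Different end pairs exclude parallel
  paths; otherwise two paths could share a bare edge between branch vertices.\<close>

definition path_system ::
    "'i set \<Rightarrow> 'a set \<Rightarrow> ('i \<Rightarrow> 'a list) \<Rightarrow> ('a, 'b) pre_digraph \<Rightarrow> bool" where
  "path_system I S P G \<longleftrightarrow>
     verts G = S \<union> (\<Union>e\<in>I. set (P e)) \<and> arcs_ends G = (\<Union>e\<in>I. path_edges (P e)) \<and>
     (\<forall>e\<in>I. distinct (P e) \<and> 2 \<le> length (P e) \<and> set (P e) \<inter> S = {hd (P e), last (P e)}) \<and>
     (\<forall>e\<in>I. \<forall>e'\<in>I. e \<noteq> e' \<longrightarrow>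
        set (P e) \<inter> set (P e') \<subseteq> S \<and> {hd (P e), last (P e)} \<noteq> {hd (P e'), last (P e')})"

lemma path_systemD:
  assumes "path_system I S P G"
  shows "verts G = S \<union> (\<Union>e\<in>I. set (P e))"
    and "arcs_ends G = (\<Union>e\<in>I. path_edges (P e))"
    and "e \<in> I \<Longrightarrow> distinct (P e)" "e \<in> I \<Longrightarrow> 2 \<le> length (P e)"
    and "e \<in> I \<Longrightarrow> set (P e) \<inter> S = {hd (P e), last (P e)}"
    and "e \<in> I \<Longrightarrow> e' \<in> I \<Longrightarrow> e \<noteq> e' \<Longrightarrow> set (P e) \<inter> set (P e') \<subseteq> S"
    and "e \<in> I \<Longrightarrow> e' \<in> I \<Longrightarrow> e \<noteq> e' \<Longrightarrow> {hd (P e), last (P e)} \<noteq> {hd (P e'), last (P e')}"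
proof -
  note * = assms[unfolded path_system_def]
  show "verts G = S \<union> (\<Union>e\<in>I. set (P e))" "arcs_ends G = (\<Union>e\<in>I. path_edges (P e))"
    using * by (simp_all only:)
  note path = *[THEN conjunct2, THEN conjunct2, THEN conjunct1, THEN bspec]
  show "e \<in> I \<Longrightarrow> distinct (P e)" "e \<in> I \<Longrightarrow> 2 \<le> length (P e)"
    "e \<in> I \<Longrightarrow> set (P e) \<inter> S = {hd (P e), last (P e)}"
    by (simp_all only: path)
  note disj = *[THEN conjunct2, THEN conjunct2, THEN conjunct2, THEN bspec, THEN bspec, THEN mp]
  show "e \<in> I \<Longrightarrow> e' \<in> I \<Longrightarrow> e \<noteq> e' \<Longrightarrow> set (P e) \<inter> set (P e') \<subseteq> S"
    by (rule disj[THEN conjunct1])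
  show "e \<in> I \<Longrightarrow> e' \<in> I \<Longrightarrow> e \<noteq> e' \<Longrightarrow> {hd (P e), last (P e)} \<noteq> {hd (P e'), last (P e')}"
    by (rule disj[THEN conjunct2])
qed

text \<open>Both ends of a shared edge would be branch vertices, hence the two ends of either path,
  contrary to the different end pairs.\<close>

lemma path_system_edge_unique:
  assumes PS: "path_system I S P G" and e: "e \<in> I" "e' \<in> I"
    and uv: "(u, v) \<in> path_edges (P e)" "(u, v) \<in> path_edges (P e')" "u \<noteq> v"
  shows "e = e'"
proof (rule ccontr)
  assume ne: "e \<noteq> e'"
  have mem: "u \<in> set (P e)" "v \<in> set (P e)" "u \<in> set (P e')" "v \<in> set (P e')"
    using uv(1,2) path_edges_subset[of "P e"] path_edges_subset[of "P e'"] by auto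
  then have "u \<in> S" "v \<in> S" using path_systemD(6)[OF PS e ne] by auto
  have "{hd (P a), last (P a)} = {u, v}" if "a \<in> {e, e'}" for a
  proof -
    have "u \<in> {hd (P a), last (P a)}" "v \<in> {hd (P a), last (P a)}"
      using mem \<open>u \<in> S\<close> \<open>v \<in> S\<close> path_systemD(5)[OF PS, of a] e that by auto
    with uv(3) show ?thesis by auto
  qed
  then show False using path_systemD(7)[OF PS e ne] by simp
qed

section \<open>Effect of splitting one edge\<close>

context subdiv_step
begin

text \<open>Removing two arcs removes their end pairs only because no parallel arc keeps these pairs
  alive.\<close>

lemma arcs_ends_H:
  assumes "nomulti_digraph G"
  shows "arcs_ends H = arcs_ends G - {(u, v), (v, u)} \<union> {(u, w), (w, u), (v, w), (w, v)}"
proof -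
  have "arc_to_ends G ` (arcs G - {uv, rev_G uv}) = arcs_ends G - arc_to_ends G ` {uv, rev_G uv}"
    unfolding arcs_ends_def using in_arcs_G
    by (intro inj_on_image_set_diff[OF nomulti_digraph.inj_on_arc_to_ends[OF assms]]) blast+
  moreover have "arcs H = {uw, rev_H uw, vw, rev_H vw} \<union> (arcs G - {uv, rev_G uv})"
    using in_arcs_H not_in_arcs_H unfolding arcs_H by blast
  then have "arcs_ends H = arc_to_ends G ` {uw, rev_H uw, vw, rev_H vw} \<union>
      arc_to_ends G ` (arcs G - {uv, rev_G uv})"
    unfolding arcs_ends_def arc_to_ends_eq by (simp only: image_Un)
  moreover have "arc_to_ends G ` {uv, rev_G uv} = {(u, v), (v, u)}"
    by (simp add: arc_to_ends_def)
  moreover have "arc_to_ends G ` {uw, rev_H uw, vw, rev_H vw} = {(u, w), (w, u), (v, w), (w, v)}"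
    using subdiv_ate(3,4) subdiv_ate_H_rev unfolding arc_to_ends_eq by simp
  ultimately show ?thesis by (simp only: Un_commute)
qed

lemma simple_H:
  assumes "nomulti_digraph G" "loopfree_digraph G"
  shows "nomulti_digraph H" "loopfree_digraph H"
proof -
  interpret nomulti_digraph G by fact
  interpret loopfree_digraph G by fact
  have "u \<noteq> v" using no_loops[of uv] in_arcs_G by simp
  have new: "tail H a = w \<or> head H a = w" if "a \<in> {uw, rev_H uw, vw, rev_H vw}" for a
    using that by auto
  have old: "tail H a \<noteq> w" "head H a \<noteq> w" if "a \<in> arcs G" for a
    using that not_in_verts_G by (auto simp: tail_eq head_eq)
  show "nomulti_digraph H"
  proof
    fix a b assume ab: "a \<in> arcs H" "b \<in> arcs H" "arc_to_ends H a = arc_to_ends H b"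
    have "a \<in> arcs G \<longleftrightarrow> b \<in> arcs G"
      using ab new old by (fastforce simp: arcs_H arc_to_ends_def)
    show "a = b"
    proof (cases "a \<in> arcs G")
      case True
      then show ?thesis
        using \<open>a \<in> arcs G \<longleftrightarrow> b \<in> arcs G\<close> ab(3) no_multi_arcs unfolding arc_to_ends_eq by blast
    next
      case False
      then have "a \<in> {uw, rev_H uw, vw, rev_H vw}" "b \<in> {uw, rev_H uw, vw, rev_H vw}"
        using \<open>a \<in> arcs G \<longleftrightarrow> b \<in> arcs G\<close> ab(1,2) by (auto simp: arcs_H)
      then show ?thesis
        using ab(3) \<open>u \<noteq> v\<close> subdiv_distinct_verts0 by (auto simp: arc_to_ends_def)
    qed
  qed
  show "loopfree_digraph H"
  proof
    fix a assume "a \<in> arcs H"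
    then consider "a \<in> arcs G" | "a \<in> {uw, rev_H uw, vw, rev_H vw}"
      by (auto simp: arcs_H)
    then show "tail H a \<noteq> head H a"
    proof cases
      case 1
      then show ?thesis using no_loops by (simp add: tail_eq head_eq)
    next
      case 2
      then show ?thesis using subdiv_distinct_verts0 by auto
    qed
  qed
qed

text \<open>Exactly one path \<open>e0\<close> uses the split edge, and the new vertex
  \<open>w\<close> becomes an inner vertex of that path alone.\<close>

lemma path_system_H:
  assumes "nomulti_digraph G" "loopfree_digraph G" and PS: "path_system I S P G"
  shows "path_system I S (\<lambda>e. insert_between u v w (P e)) H"
proof -
  interpret nomulti_digraph G by fact
  interpret loopfree_digraph G by fact
  let ?Q = "\<lambda>e. insert_between u v w (P e)"
  have "u \<noteq> v" using no_loops[of uv] in_arcs_G by simp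
  note verts = path_systemD(1)[OF PS] and ends = path_systemD(2)[OF PS]
    and path = path_systemD(3-5)[OF PS] and disj = path_systemD(6,7)[OF PS]
  have w: "w \<notin> S" "\<And>e. e \<in> I \<Longrightarrow> w \<notin> set (P e)"
    using not_in_verts_G verts by auto
  have "(u, v) \<in> arcs_ends G"
    using in_arcs_G by (auto simp: arcs_ends_conv intro!: image_eqI[of _ _ uv])
  then obtain e0 where e0: "e0 \<in> I" "(u, v) \<in> path_edges (P e0)"
    using ends by auto
  have Q_other: "(u, v) \<notin> path_edges (P e)" "(v, u) \<notin> path_edges (P e)" "?Q e = P e"
    if "e \<in> I" "e \<noteq> e0" for e
  proof -
    show *: "(u, v) \<notin> path_edges (P e)"
      using path_system_edge_unique[OF PS that(1) e0(1) _ e0(2) \<open>u \<noteq> v\<close>] that(2) by blast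
    then show "(v, u) \<notin> path_edges (P e)" using path_edges_sym by fast
    show "?Q e = P e" using * by (rule insert_between_id)
  qed
  have set_Q: "set (?Q e) = (if e = e0 then insert w (set (P e)) else set (P e))" if "e \<in> I" for e
    using Q_other(3)[OF that] set_insert_between[OF e0(2)] by auto
  have edges_Q: "path_edges (?Q e0) =
      path_edges (P e0) - {(u, v), (v, u)} \<union> {(u, w), (w, u), (v, w), (w, v)}"
    using path_edges_insert_between path(1) w(2) e0 by metis
  show ?thesis
    unfolding path_system_def
  proof (intro conjI ballI impI)
    show "verts H = S \<union> (\<Union>e\<in>I. set (?Q e))"
      using verts_H verts set_Q e0(1) by auto
    define R where "R = (\<Union>e\<in>I - {e0}. path_edges (P e))"
    have split: "(\<Union>e\<in>I. h e) = h e0 \<union> (\<Union>e\<in>I - {e0}. h e)" for h :: "_ \<Rightarrow> ('a \<times> 'a) set"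
      using e0(1) by blast
    have "(\<Union>e\<in>I - {e0}. path_edges (?Q e)) = R"
      unfolding R_def by (intro SUP_cong refl arg_cong[of _ _ path_edges] Q_other(3)) auto
    then have "(\<Union>e\<in>I. path_edges (?Q e)) = path_edges (?Q e0) \<union> R"
      by (subst split) simp
    moreover have "arcs_ends G = path_edges (P e0) \<union> R"
      unfolding ends R_def by (rule split)
    moreover have "(u, v) \<notin> R" "(v, u) \<notin> R"
      unfolding R_def using Q_other(1,2) by simp_all
    ultimately show "arcs_ends H = (\<Union>e\<in>I. path_edges (?Q e))"
      unfolding arcs_ends_H[OF assms(1)] edges_Q by auto
  next
    fix e assume e: "e \<in> I"
    show "distinct (?Q e)" using path(1) w(2) e by (simp add: distinct_insert_between)
    show "2 \<le> length (?Q e)" using path(2)[OF e] length_insert_between[of "P e" u v w] by linarith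
    show "set (?Q e) \<inter> S = {hd (?Q e), last (?Q e)}"
      using path(3)[OF e] w(1) unfolding set_Q[OF e] by (cases "e = e0") simp_all
  next
    fix e e' assume e: "e \<in> I" "e' \<in> I" "e \<noteq> e'"
    show "set (?Q e) \<inter> set (?Q e') \<subseteq> S"
      using disj(1)[OF e] w(2)[OF e(1)] w(2)[OF e(2)] e(3) unfolding set_Q[OF e(1)] set_Q[OF e(2)]
      by (cases "e = e0"; cases "e' = e0") auto
    show "{hd (?Q e), last (?Q e)} \<noteq> {hd (?Q e'), last (?Q e')}"
      using disj(2)[OF e] by simp
  qed
qed

end

text \<open>Simplicity belongs to the invariant because each splitting step relies on it; the
  preserved ends tell later which path replaces which edge.\<close>

lemma subdivision_path_system:
  assumes "subdivision (K, rev_K) (G, rev_G)"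
    and "nomulti_digraph K" "loopfree_digraph K" "path_system I S P K"
  shows "nomulti_digraph G \<and> loopfree_digraph G \<and>
    (\<exists>Q. path_system I S Q G \<and> (\<forall>e\<in>I. hd (Q e) = hd (P e) \<and> last (Q e) = last (P e)))"
  using assms(1)
proof (induction rule: subdivision_induct)
  case base
  show ?case using assms(2-4) by blast
next
  case (divide G rev_G H rev_H u v w uv uw vw)
  interpret subdiv_step G rev_G H rev_H u v w uv uw vw
    using divide by unfold_locales
  from divide.IH obtain Q where "path_system I S Q G"
    "\<forall>e\<in>I. hd (Q e) = hd (P e) \<and> last (Q e) = last (P e)"
    and "nomulti_digraph G" "loopfree_digraph G" by blast
  then show ?case
    using simple_H path_system_H[of I S Q]
    by (auto intro!: exI[of _ "\<lambda>e. insert_between u v w (Q e)"])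
qed

text \<open>Words on different paths can conflict only at branch vertices, where \<open>lab\<close>
  makes them agree. Any other vertex determines its path and its position, so the definite
  description is meaningful.\<close>

lemma path_system_labelling:
  assumes PS: "path_system I S P G"
    and len: "\<And>e. e \<in> I \<Longrightarrow> length (W e) = length (P e)"
    and ends: "\<And>e. e \<in> I \<Longrightarrow> hd (W e) = lab (hd (P e))" "\<And>e. e \<in> I \<Longrightarrow> last (W e) = lab (last (P e))"
  shows "\<exists>f. \<forall>e\<in>I. map f (P e) = W e"
proof -
  note path = path_systemD(3-5)[OF PS] and disj = path_systemD(6)[OF PS]
  define f where "f v = (if v \<in> S then lab v
    else THE t. \<exists>e\<in>I. \<exists>i<length (P e). P e ! i = v \<and> W e ! i = t)" for v
  have "f (P e ! i) = W e ! i" if e: "e \<in> I" and i: "i < length (P e)" for e i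
  proof (cases "P e ! i \<in> S")
    case True
    then have "P e ! i = hd (P e) \<or> P e ! i = last (P e)"
      using path(3)[OF e] i nth_mem by blast
    moreover have "P e \<noteq> []" using i by auto
    ultimately have "i = 0 \<or> i = length (P e) - 1"
      using path(1)[OF e] i by (auto simp: hd_conv_nth last_conv_nth nth_eq_iff_index_eq)
    moreover have "W e \<noteq> []" using \<open>P e \<noteq> []\<close> len[OF e] by auto
    ultimately show ?thesis
      using True ends[OF e] \<open>P e \<noteq> []\<close> len[OF e] by (auto simp: f_def hd_conv_nth last_conv_nth)
  next
    case False
    have "(THE t. \<exists>e'\<in>I. \<exists>j<length (P e'). P e' ! j = P e ! i \<and> W e' ! j = t) = W e ! i"
    proof (rule the_equality)
      show "\<exists>e'\<in>I. \<exists>j<length (P e'). P e' ! j = P e ! i \<and> W e' ! j = W e ! i"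
        using e i by blast
      fix t assume "\<exists>e'\<in>I. \<exists>j<length (P e'). P e' ! j = P e ! i \<and> W e' ! j = t"
      then obtain e' j where j: "e' \<in> I" "j < length (P e')" "P e' ! j = P e ! i" "W e' ! j = t"
        by blast
      have "P e ! i \<in> set (P e') \<inter> set (P e)"
        using i nth_mem[OF j(2)] j(3) by simp
      then have "e' = e"
        using disj[OF j(1) e] False by blast
      then show "t = W e ! i"
        using j path(1)[OF e] i nth_eq_iff_index_eq by metis
    qed
    then show ?thesis using False by (simp add: f_def)
  qed
  then have "\<forall>e\<in>I. map f (P e) = W e"
    using len by (simp add: list_eq_iff_nth_eq)
  then show ?thesis by (rule exI[of _ f])
qed

section \<open>Subdivisions of the complete graph on four vertices\<close>

lemma edge_pairs_iff: "(i, j) \<in> set edge_pairs \<longleftrightarrow> i < j \<and> j < 4"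
proof -
  have "i < j \<and> j < 4 \<longleftrightarrow> j = 1 \<and> i = 0 \<or> j = 2 \<and> (i = 0 \<or> i = 1) \<or> j = 3 \<and> (i = 0 \<or> i = 1 \<or> i = 2)"
    by presburger
  then show ?thesis by (auto simp: edge_pairs_def)
qed

text \<open>The start of the induction: every edge is a path without inner vertices.\<close>

lemma path_system_complete:
  assumes "arcs_ends K = {(u, v). (u, v) \<in> verts K \<times> verts K \<and> u \<noteq> v}"
    and b: "bij_betw b {..<4} (verts K)"
  shows "path_system (set edge_pairs) (verts K) (\<lambda>(i, j). [b i, b j]) K"
proof -
  have inj: "b i = b j \<longleftrightarrow> i = j" if "i < 4" "j < 4" for i j
    using b that by (auto simp: bij_betw_def inj_on_eq_iff)
  have in_K: "b i \<in> verts K" if "i < 4" for i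
    using b that by (auto simp: bij_betw_def)
  have ends: "arcs_ends K = (\<Union>(i, j)\<in>set edge_pairs. {(b i, b j), (b j, b i)})"
  proof (intro set_eqI iffI; clarify)
    fix u v assume "(u, v) \<in> arcs_ends K"
    then have "u \<in> b ` {..<4}" "v \<in> b ` {..<4}" "u \<noteq> v"
      using assms by (auto simp: bij_betw_def)
    then obtain i j where "u = b i" "v = b j" "i < 4" "j < 4" "i \<noteq> j" by auto
    then show "(u, v) \<in> (\<Union>(i, j)\<in>set edge_pairs. {(b i, b j), (b j, b i)})"
      by (cases "i < j") (force simp: edge_pairs_iff)+
  next
    fix u v i j assume "(i, j) \<in> set edge_pairs" "(u, v) \<in> {(b i, b j), (b j, b i)}"
    then show "(u, v) \<in> arcs_ends K"
      using in_K inj[of i j] assms(1) by (auto simp: edge_pairs_iff)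
  qed
  show ?thesis
    unfolding path_system_def
  proof (intro conjI ballI impI)
    show "verts K = verts K \<union> (\<Union>e\<in>set edge_pairs. set (case e of (i, j) \<Rightarrow> [b i, b j]))"
      using in_K by (auto simp: edge_pairs_iff)
    show "arcs_ends K = (\<Union>e\<in>set edge_pairs. path_edges (case e of (i, j) \<Rightarrow> [b i, b j]))"
      unfolding ends by (intro SUP_cong refl) auto
  next
    fix e assume e: "e \<in> set edge_pairs"
    obtain i j where ij: "e = (i, j)" by (cases e)
    then have "i < j" "j < 4" using e by (auto simp: edge_pairs_iff)
    then show "distinct (case e of (i, j) \<Rightarrow> [b i, b j])" "2 \<le> length (case e of (i, j) \<Rightarrow> [b i, b j])"
      "set (case e of (i, j) \<Rightarrow> [b i, b j]) \<inter> verts K =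
        {hd (case e of (i, j) \<Rightarrow> [b i, b j]), last (case e of (i, j) \<Rightarrow> [b i, b j])}"
      using in_K inj[of i j] ij by auto
  next
    fix e e' assume e: "e \<in> set edge_pairs" "e' \<in> set edge_pairs" "e \<noteq> e'"
    obtain i j i' j' where ij: "e = (i, j)" "e' = (i', j')" by (cases e; cases e')
    show "set (case e of (i, j) \<Rightarrow> [b i, b j]) \<inter> set (case e' of (i, j) \<Rightarrow> [b i, b j]) \<subseteq> verts K"
      using e ij in_K by (auto simp: edge_pairs_iff)
    have "i < j" "j < 4" "i' < j'" "j' < 4" "(i, j) \<noteq> (i', j')"
      using e ij by (auto simp: edge_pairs_iff)
    then have "{b i, b j} \<noteq> {b i', b j'}"
      using inj[of i i'] inj[of j j'] inj[of i j'] inj[of j i'] by (auto simp: doubleton_eq_iff)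
    then show "{hd (case e of (i, j) \<Rightarrow> [b i, b j]), last (case e of (i, j) \<Rightarrow> [b i, b j])} \<noteq>
      {hd (case e' of (i, j) \<Rightarrow> [b i, b j]), last (case e' of (i, j) \<Rightarrow> [b i, b j])}"
      using ij by simp
  qed
qed

lemma path_system_neighbours_inner:
  assumes PS: "path_system I S P G" and e: "e \<in> I" and v: "v \<in> set (P e)" "v \<notin> S"
  shows "{u. (v, u) \<in> arcs_ends G} = {u. (v, u) \<in> path_edges (P e)}"
proof -
  have "e' = e" if "e' \<in> I" "(v, u) \<in> path_edges (P e')" for e' u
  proof -
    have "v \<in> set (P e')" using that(2) path_edges_subset[of "P e'"] by auto
    then show ?thesis using path_systemD(6)[OF PS that(1) e] v by auto
  qed
  then show ?thesis using e unfolding path_systemD(2)[OF PS] by auto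
qed

lemma path_system_neighbours_branch:
  assumes PS: "path_system (set edge_pairs) S P G"
    and b: "inj_on b {..<4}" "\<And>i. i < 4 \<Longrightarrow> b i \<in> S"
    and ends: "\<And>i j. (i, j) \<in> set edge_pairs \<Longrightarrow> hd (P (i, j)) = b i \<and> last (P (i, j)) = b j"
    and i: "i < 4"
  shows "{u. (b i, u) \<in> arcs_ends G} =
    (\<lambda>j. if i < j then P (i, j) ! 1 else P (j, i) ! (length (P (j, i)) - 2)) ` ({..<4} - {i})"
    (is "?N = ?h ` _")
proof -
  have first: "(b j, u) \<in> path_edges (P (j, l)) \<longleftrightarrow> u = P (j, l) ! 1"
    and last: "(b l, u) \<in> path_edges (P (j, l)) \<longleftrightarrow> u = P (j, l) ! (length (P (j, l)) - 2)"
    if "(j, l) \<in> set edge_pairs" for j l u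
    using neighbours_hd[OF path_systemD(3,4)[OF PS that]]
      neighbours_last[OF path_systemD(3,4)[OF PS that]] ends[OF that] by auto
  have "?N \<subseteq> ?h ` ({..<4} - {i})"
  proof
    fix u assume "u \<in> ?N"
    then obtain j l where jl: "(j, l) \<in> set edge_pairs" "(b i, u) \<in> path_edges (P (j, l))"
      unfolding path_systemD(2)[OF PS] by auto
    then have "b i \<in> set (P (j, l)) \<inter> S"
      using path_edges_subset[of "P (j, l)"] b(2)[OF i] by auto
    then have "b i = b j \<or> b i = b l"
      unfolding path_systemD(5)[OF PS jl(1)] using ends[OF jl(1)] by simp
    then have "i = j \<or> i = l"
      using b(1) i jl(1) by (auto simp: edge_pairs_iff inj_on_eq_iff)
    then show "u \<in> ?h ` ({..<4} - {i})"
    proof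
      assume "i = j"
      then have "l \<in> {..<4} - {i}" "u = ?h l" using jl first by (auto simp: edge_pairs_iff)
      then show ?thesis by blast
    next
      assume "i = l"
      then have "j \<in> {..<4} - {i}" "u = ?h j" using jl last by (auto simp: edge_pairs_iff)
      then show ?thesis by blast
    qed
  qed
  moreover have "?h j \<in> ?N" if "j \<in> {..<4} - {i}" for j
  proof (cases "i < j")
    case True
    then have "(i, j) \<in> set edge_pairs" using that by (simp add: edge_pairs_iff)
    then show ?thesis
      using first True unfolding path_systemD(2)[OF PS] by fastforce
  next
    case False
    then have "(j, i) \<in> set edge_pairs" using that i by (auto simp: edge_pairs_iff)
    then show ?thesis
      using last False unfolding path_systemD(2)[OF PS] by fastforce
  qed
  ultimately show ?thesis by blast
qed

theorem theorem4p2: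
  fixes K G :: "('a, 'b) pre_digraph" and rev_K rev_G :: "'b \<Rightarrow> 'b"
  assumes "K\<^bsub>4\<^esub> K"
    and "subdivision (K, rev_K) (G, rev_G)"
  shows "\<exists>c. crumby_coloring G c"
proof -
  define S where "S = verts K"
  from assms(1) have "graph K" and card_K: "card S = 4"
    and ends_K: "arcs_ends K = {(u, v). (u, v) \<in> verts K \<times> verts K \<and> u \<noteq> v}"
    by (simp_all add: complete_digraph_def S_def)
  interpret K: graph K by fact
  obtain b :: "nat \<Rightarrow> 'a" where b: "bij_betw b {..<4} (verts K)"
    using ex_bij_betw_nat_finite[of "verts K"] card_K by (auto simp: S_def atLeast0LessThan)
  then have inj: "inj_on b {..<4}" and img: "b ` {..<4} = S"
    by (auto simp: bij_betw_def S_def)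
  obtain P where G: "nomulti_digraph G" and PS: "path_system (set edge_pairs) S P G"
    and "\<forall>e\<in>set edge_pairs. hd (P e) = hd (case e of (i, j) \<Rightarrow> [b i, b j]) \<and>
      last (P e) = last (case e of (i, j) \<Rightarrow> [b i, b j])"
    using subdivision_path_system[OF assms(2) K.nomulti_digraph K.loopfree_digraph_axioms
        path_system_complete[OF ends_K b]] unfolding S_def by blast
  then have ends: "hd (P (i, j)) = b i \<and> last (P (i, j)) = b j" if "(i, j) \<in> set edge_pairs" for i j
    using that by fastforce
  have bS: "b i \<in> S" if "i < 4" for i
    using that img by blast
  interpret G: bidirected_digraph G rev_G
    using subdivision_bidir[OF assms(2)] .
  note path = path_systemD(3,4)[OF PS]
  define k where "k i j = length (P (i, j)) - 2" for i j
  from exists_roles[of k] obtain x r where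
    role: "\<forall>i \<in> {0,1,2,3}. role_ok (x i) (map (r i) (filter (\<lambda>j. j \<noteq> i) [0,1,2,3]))" and
    spells: "\<forall>i j. (i, j) \<in> set edge_pairs \<longrightarrow> (\<exists>w. spells w (k i j) (x i) (r i j) (r j i) (x j))"
    by (elim exE conjE)
  define W where "W = (\<lambda>(i, j). SOME w. spells w (k i j) (x i) (r i j) (r j i) (x j))"
  have W: "spells (W (i, j)) (k i j) (x i) (r i j) (r j i) (x j)" if "(i, j) \<in> set edge_pairs" for i j
    unfolding W_def prod.case by (rule someI_ex[OF spells[rule_format, OF that]])
  have len: "k i j + 2 = length (P (i, j))" if "(i, j) \<in> set edge_pairs" for i j
    using path(2)[OF that] by (simp add: k_def)
  define lab where "lab v = x (inv_into {..<4} b v)" for v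
  have lab: "lab (b i) = x i" if "i < 4" for i
    using that inj by (simp add: lab_def)
  have "\<exists>f. \<forall>e\<in>set edge_pairs. map f (P e) = W e"
  proof (rule path_system_labelling[OF PS])
    fix e assume e: "e \<in> set edge_pairs"
    obtain i j where ij: "e = (i, j)" by (cases e)
    have "i < 4" "j < 4" using e ij by (auto simp: edge_pairs_iff)
    then show "length (W e) = length (P e)" "hd (W e) = lab (hd (P e))" "last (W e) = lab (last (P e))"
      using W[of i j] len[of i j] ends[of i j] e ij lab by (simp_all add: spells_def)
  qed
  then obtain f where f: "\<And>e. e \<in> set edge_pairs \<Longrightarrow> map f (P e) = W e" by blast
  have nth: "f (P e ! n) = W e ! n" if "e \<in> set edge_pairs" "n < length (P e)" for e n
    using f[OF that(1)] that(2) nth_map[of n "P e" f] by simp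
  have words: "word_ok (map f (P e))" if "e \<in> set edge_pairs" for e
    using W that by (cases e) (simp add: f spells_def)
  have fb: "f (b i) = x i" if i: "i < 4" for i
  proof -
    have hd: "f (hd (P e)) = hd (W e)" and last: "f (last (P e)) = last (W e)"
      if e: "e \<in> set edge_pairs" for e
    proof -
      have "P e \<noteq> []" using path(2)[OF e] by auto
      then show "f (hd (P e)) = hd (W e)" "f (last (P e)) = last (W e)"
        by (simp_all add: hd_map last_map flip: f[OF e])
    qed
    show ?thesis
    \<comment> \<open>Any path ending at \<open>b i\<close> reveals its label: vertices other than 3
      start a path to 3, and 3 ends the path from 0.\<close>
    proof (cases "i = 3")
      case True
      then have "(0, i) \<in> set edge_pairs" by (simp add: edge_pairs_iff)
      then show ?thesis using last[of "(0, i)"] W[of 0 i] ends[of 0 i] by (simp add: spells_def)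
    next
      case False
      then have "(i, 3) \<in> set edge_pairs" using i by (simp add: edge_pairs_iff)
      then show ?thesis using hd[of "(i, 3)"] W[of i 3] ends[of i 3] by (simp add: spells_def)
    qed
  qed
  have "\<exists>ns. {u. (v, u) \<in> arcs_ends G} = set ns \<and> role_ok (f v) (map (\<lambda>u. red (f u)) ns)"
    if v: "v \<in> verts G" for v
  proof (cases "v \<in> S")
    case True
    then obtain i where i: "i < 4" "v = b i" using img by auto
    define h where "h j = (if i < j then P (i, j) ! 1 else P (j, i) ! (length (P (j, i)) - 2))" for j
    define js where "js = filter (\<lambda>j. j \<noteq> i) [0,1,2,3]"
    have four: "{..<4} = {0,1,2,3::nat}" by auto
    have set_js: "set js = {..<4} - {i}"
      unfolding js_def set_filter four list.set by blast
    have "{u. (v, u) \<in> arcs_ends G} = h ` ({..<4} - {i})"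
      unfolding i(2) h_def by (rule path_system_neighbours_branch[OF PS inj bS ends i(1)])
    also have "\<dots> = set (map h js)"
      using set_js by simp
    finally have nbrs: "{u. (v, u) \<in> arcs_ends G} = set (map h js)" .
    \<comment> \<open>The words guarantee the planned colors only up to the slack of
      \<open>end_ok\<close>, which \<open>role_ok_mono\<close> absorbs below.\<close>
    have "end_ok (x i) (r i j) (red (f (h j)))" if "j \<in> set js" for j
    proof (cases "i < j")
      case True
      then have ij: "(i, j) \<in> set edge_pairs" using that by (simp add: set_js edge_pairs_iff)
      then show ?thesis
        using W[OF ij] nth[OF ij, of 1] len[OF ij] True by (simp add: h_def spells_def)
    next
      case False
      then have ji: "(j, i) \<in> set edge_pairs" using that i(1) by (simp add: set_js edge_pairs_iff)
      then have "f (h j) = W (j, i) ! k j i"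
        using nth[OF ji, of "k j i"] len[OF ji] False by (simp add: h_def k_def)
      then show ?thesis
        using W[OF ji] by (simp add: spells_def)
    qed
    moreover have "role_ok (x i) (map (r i) js)"
      unfolding js_def using i(1) four by (intro role[THEN bspec]) blast
    ultimately have "role_ok (x i) (map (\<lambda>j. red (f (h j))) js)"
      by (rule role_ok_mono[rotated])
    then have "role_ok (f v) (map (\<lambda>u. red (f u)) (map h js))"
      using fb i by (simp add: o_def)
    with nbrs show ?thesis by (intro exI[of _ "map h js"] conjI)
  next
    case False
    with v obtain e where e: "e \<in> set edge_pairs" "v \<in> set (P e)"
      unfolding path_systemD(1)[OF PS] by auto
    have "{hd (P e), last (P e)} \<subseteq> S" using path_systemD(5)[OF PS e(1)] by blast
    then have "v \<noteq> hd (P e)" "v \<noteq> last (P e)" using False by auto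
    then show ?thesis
      unfolding path_system_neighbours_inner[OF PS e False]
      by (rule neighbours_inner[OF path(1)[OF e(1)] words[OF e(1)] e(2)])
  qed
  moreover have "\<not> (f u = Center \<and> f v = Center)" if uv: "(u, v) \<in> arcs_ends G" for u v
  proof -
    from uv obtain e where "e \<in> set edge_pairs" "(u, v) \<in> path_edges (P e)"
      unfolding path_systemD(2)[OF PS] by auto
    then show ?thesis using centers_not_adjacent[OF words] by simp
  qed
  ultimately have "crumby_coloring G (\<lambda>v. if f v = Bl then Blue else Red)"
    by (rule crumby_coloringI[OF G G.sym_arcs])
  then show ?thesis by (rule exI[where P = "crumby_coloring G"])
qed

end
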